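(* The map $\Phi\colon (\mathcal{P}\times\mathcal{P})/\mathrm{SL}_2(\mathbb{Z})\longrightarrow \mathbf{SL}_2$, which sends the $\mathrm{SL}_2(\mathbb{Z})$-orbit of a pair $(\gamma,\delta)$ of bi-infinite paths in the Farey graph to $\widetilde{\Phi}(\gamma,\delta)=\pm\mathbf{M}$, is a one-to-one correspondence (a bijection).
   Context: An $\mathrm{SL}_2$-tiling is a function $\mathbf{M}\colon\mathbb{Z}\times\mathbb{Z}\to\mathbb{Z}$, with $m_{i,j}=\mathbf{M}(i,j)$, such that $m_{i,j}m_{i+1,j+1}-m_{i,j+1}m_{i+1,j}=1$ for all $i,j\in\mathbb{Z}$. It is tame if every $3\times 3$ submatrix of consecutive rows and columns, with entries $m_{i+p,j+q}$, $0\leq p,q\leq 2$, has determinant $0$. $\mathbf{SL}_2$ denotes the set of all tame $\mathrm{SL}_2$-tilings modulo the equivalence relation identifying $\mathbf{M}$ and $-\mathbf{M}$; its elements are written $\pm\mathbf{M}$. A reduced rational is an expression $a/b$ with $a,b$ coprime integers, where $1/0$ and $(-1)/0$ are allowed and both represent $\infty$; each element of $\mathbb{Q}_\infty=\mathbb{Q}\cup\{\infty\}$ has exactly two such representations, $a/b$ and $(-a)/(-b)$. The Farey graph $\mathcal{F}$ has vertex set $\mathbb{Q}_\infty$, with reduced rationals $a/b$ and $c/d$ adjacent if and only if $ad-bc=\pm1$. A bi-infinite path in $\mathcal{F}$ is a sequence $\langle\dots,v_{-1},v_0,v_1,v_2,\dots\rangle$ of vertices indexed by $\mathbb{Z}$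 with $v_i$ adjacent to $v_{i+1}$ for all $i\in\mathbb{Z}$. $\mathcal{P}$ is the set of all bi-infinite paths. The vertices of such a path can be written as reduced rationals $v_i=a_i/b_i$ with $a_ib_{i+1}-a_{i+1}b_i=1$ for all $i$, in exactly two ways (which differ by changing the sign of all $a_i,b_i$ simultaneously). $\mathrm{SL}_2(\mathbb{Z})$ acts on $\mathbb{Q}_\infty$ by $\begin{pmatrix}a&b\\c&d\end{pmatrix}(z)=\frac{az+b}{cz+d}$; this preserves adjacency in $\mathcal{F}$, so $\mathrm{SL}_2(\mathbb{Z})$ acts on $\mathcal{P}$ (vertexwise) and on $\mathcal{P}\times\mathcal{P}$ (diagonally). Given $(\gamma,\delta)\in\mathcal{P}\times\mathcal{P}$, write the vertices of $\gamma$ as reduced rationals $a_i/b_i$ with $a_ib_{i+1}-a_{i+1}b_i=1$ and the vertices of $\delta$ as reduced rationals $c_j/d_j$ with $c_jd_{j+1}-c_{j+1}d_j=1$ ($i,j\in\mathbb{Z}$). Put $m_{i,j}=a_id_j-b_ic_j$. Then $\mathbf{M}$ is a tame $\mathrm{SL}_2$-tiling, and $\widetilde{\Phi}(\gamma,\delta)=\pm\mathbf{M}$ is well defined and constant on $\mathrm{SL}_2(\mathbb{Z})$-orbits, so it induces the map $\Phi$. *)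

theory Defs
  imports "HOL-Analysis.Determinants"
begin

type_synonym tiling = "int \<Rightarrow> int \<Rightarrow> int"

definition SL2_tiling :: "tiling \<Rightarrow> bool" where
  "SL2_tiling m \<longleftrightarrow>
     (\<forall>i j. m i j * m (i + 1) (j + 1) - m i (j + 1) * m (i + 1) j = 1)"

definition tame :: "tiling \<Rightarrow> bool" where
  "tame m \<longleftrightarrow>
     (\<forall>i j. det (vector
        [vector [m i j,       m i (j + 1),       m i (j + 2)],
         vector [m (i + 1) j, m (i + 1) (j + 1), m (i + 1) (j + 2)],
         vector [m (i + 2) j, m (i + 2) (j + 1), m (i + 2) (j + 2)]] :: int^3^3) = 0)"

definition tame_SL2_tilings :: "tiling set" where
  "tame_SL2_tilings = {m. SL2_tiling m \<and> tame m}"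

definition sign_rel :: "(tiling \<times> tiling) set" where
  "sign_rel = {(m, n). m \<in> tame_SL2_tilings \<and> n \<in> tame_SL2_tilings \<and>
                       (n = m \<or> n = (\<lambda>i j. - m i j))}"

definition tame_SL2_tilings_mod_sign :: "tiling set set" where
  "tame_SL2_tilings_mod_sign = tame_SL2_tilings // sign_rel"

datatype rat_infty = Finite rat | Infty

text \<open>The reduced rational \<open>a / b\<close> represents \<open>v\<close>. For \<open>b = 0\<close>, coprimality forces
  \<open>a\<close> to be \<open>1\<close> or \<open>-1\<close>.\<close>

definition reduced_rational :: "int \<Rightarrow> int \<Rightarrow> rat_infty \<Rightarrow> bool" where
  "reduced_rational a b v \<longleftrightarrow>
     coprime a b \<and> v = (if b = 0 then Infty else Finite (of_int a / of_int b))"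

definition farey_adjacent :: "rat_infty \<Rightarrow> rat_infty \<Rightarrow> bool" where
  "farey_adjacent v w \<longleftrightarrow>
     (\<exists>a b c d. reduced_rational a b v \<and> reduced_rational c d w \<and>
                (a * d - b * c = 1 \<or> a * d - b * c = -1))"

type_synonym path = "int \<Rightarrow> rat_infty"

definition farey_paths :: "path set" where
  "farey_paths = {v. \<forall>i. farey_adjacent (v i) (v (i + 1))}"

definition normalized_rep :: "path \<Rightarrow> (int \<Rightarrow> int) \<Rightarrow> (int \<Rightarrow> int) \<Rightarrow> bool" where
  "normalized_rep v a b \<longleftrightarrow>
     (\<forall>i. reduced_rational (a i) (b i) (v i)) \<and>
     (\<forall>i. a i * b (i + 1) - a (i + 1) * b i = 1)"

definition SL2Z :: "(int^2^2) set" where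
  "SL2Z = {A. det A = 1}"

fun moebius :: "int^2^2 \<Rightarrow> rat_infty \<Rightarrow> rat_infty" where
  "moebius A (Finite z) =
     (if of_int (A$2$1) * z + of_int (A$2$2) = 0 then Infty
      else Finite ((of_int (A$1$1) * z + of_int (A$1$2)) /
                   (of_int (A$2$1) * z + of_int (A$2$2))))"
| "moebius A Infty =
     (if A$2$1 = 0 then Infty else Finite (of_int (A$1$1) / of_int (A$2$1)))"

definition orbit_rel :: "((path \<times> path) \<times> (path \<times> path)) set" where
  "orbit_rel = {((\<gamma>, \<delta>), (\<gamma>', \<delta>')).
     (\<gamma>, \<delta>) \<in> farey_paths \<times> farey_paths \<and> (\<gamma>', \<delta>') \<in> farey_paths \<times> farey_paths \<and>
     (\<exists>A\<in>SL2Z. \<gamma>' = moebius A \<circ> \<gamma> \<and> \<delta>' = moebius A \<circ> \<delta>)}"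

definition path_pair_orbits :: "(path \<times> path) set set" where
  "path_pair_orbits = (farey_paths \<times> farey_paths) // orbit_rel"

text \<open>The class of \<open>m\<close> up to sign, obtained as the set of all tilings arising from the choices of
  normalized representatives: two choices for each path, differing by a global sign.\<close>

definition Phi_tilde :: "path \<times> path \<Rightarrow> tiling set" where
  "Phi_tilde = (\<lambda>(\<gamma>, \<delta>).
     {m. \<exists>a b c d. normalized_rep \<gamma> a b \<and> normalized_rep \<delta> c d \<and>
                   m = (\<lambda>i j. a i * d j - b i * c j)})"

text \<open>The common value of \<open>Phi_tilde\<close> on an orbit.\<close>

definition Phi :: "(path \<times> path) set \<Rightarrow> tiling set" where
  "Phi orb = the_elem (Phi_tilde ` orb)"

end

theory Submission
  imports Defs
begin

text \<open>Write \<open>u i = (a i, b i)\<close> and \<open>w j = (c j, d j)\<close>, so that \<open>m i j = det (u i, w j)\<close>.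
  A vector is determined by its determinants against a basis of determinant 1. Hence two
  pairs of paths with the same tiling differ by the matrix in \<open>SL2(Z)\<close> that matches the basis
  \<open>u 0, u 1\<close>. This makes the orbit relation the kernel of \<open>Phi_tilde\<close>. Conversely, tameness
  says that the columns of \<open>m\<close> satisfy \<open>m i (j + 2) = k j * m i (j + 1) - m i j\<close>
  with \<open>k j\<close> independent of the row \<open>i\<close>, so \<open>m\<close> is recovered from its rows 0, 1
  and columns 0, 1, which supply the two paths.\<close>

section \<open>Reduced rationals and the Moebius action\<close>

lemma coprime_if_det_eq_1:
  fixes a b c d :: int
  assumes "a * d - b * c = 1"
  shows "coprime a b"
proof (rule coprimeI)
  fix x assume "x dvd a" "x dvd b"
  then show "x dvd 1" using assms by (metis dvd_diff dvd_mult2)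
qed

lemma reduced_rational_exists: "\<exists>a b. reduced_rational a b v"
proof (cases v)
  case (Finite q)
  obtain a b where "quotient_of q = (a, b)" by (cases "quotient_of q")
  then have "b > 0" "coprime a b" "q = of_int a / of_int b"
    using quotient_of_denom_pos quotient_of_coprime quotient_of_div by blast+
  with Finite have "reduced_rational a b v" by (simp add: reduced_rational_def)
  then show ?thesis by blast
next
  case Infty
  then have "reduced_rational 1 0 v" by (simp add: reduced_rational_def)
  then show ?thesis by blast
qed

text \<open>Cross-multiplication and coprimality give equality of absolute values, leaving a sign
  for each entry. If an entry vanishes, its sign is free; otherwise \<open>a * d = c * b\<close>
  forces the two signs to agree.\<close>

lemma reduced_rational_unique:
  assumes v: "reduced_rational a b v" and w: "reduced_rational c d v"
  shows "\<exists>s::int. (s = 1 \<or> s = -1) \<and> c = s * a \<and> d = s * b"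
proof -
  have cop: "coprime a b" "coprime c d" using v w by (simp_all add: reduced_rational_def)
  have cross: "a * d = c * b"
  proof (cases "b = 0")
    case True
    with v w have "d = 0" by (auto simp: reduced_rational_def split: if_splits)
    with True show ?thesis by simp
  next
    case False
    with v w have "d \<noteq> 0" and "(of_int a / of_int b :: rat) = of_int c / of_int d"
      by (auto simp: reduced_rational_def split: if_splits)
    with False have "(of_int (a * d) :: rat) = of_int (c * b)"
      by (simp add: field_simps)
    then show ?thesis by (simp only: of_int_eq_iff)
  qed
  have "\<bar>a\<bar> = \<bar>c\<bar> \<and> \<bar>d\<bar> = \<bar>b\<bar>"
    using coprime_crossproduct_int[OF cop] arg_cong[OF cross, of abs] unfolding abs_mult by blast
  then have ac: "c = a \<or> c = - a" and bd: "d = b \<or> d = - b" by (auto simp: abs_eq_iff)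
  show ?thesis
  proof (cases "a = 0 \<or> b = 0")
    case True
    then show ?thesis using ac bd by force
  next
    case False
    then show ?thesis using ac bd cross by force
  qed
qed

lemma reduced_rational_uminus:
  "reduced_rational a b v \<Longrightarrow> reduced_rational (- a) (- b) v"
  by (auto simp: reduced_rational_def)

text \<open>Lifts the action to matrix multiplication on vectors \<open>(a, b)\<close>, so that
  later arguments are linear and need no case split at infinity.\<close>

lemma reduced_rational_moebius:
  assumes A: "A \<in> SL2Z" and v: "reduced_rational a b v"
  shows "reduced_rational (A$1$1 * a + A$1$2 * b) (A$2$1 * a + A$2$2 * b) (moebius A v)"
proof -
  have det: "A$1$1 * A$2$2 - A$1$2 * A$2$1 = 1"
    using A by (simp add: SL2Z_def det_2)
  let ?a = "A$1$1 * a + A$1$2 * b" and ?b = "A$2$1 * a + A$2$2 * b"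
  \<comment> \<open>Multiplication by the inverse matrix: a common divisor of the new entries also
    divides \<open>a\<close> and \<open>b\<close>.\<close>
  have inv: "a = A$2$2 * ?a - A$1$2 * ?b" "b = A$1$1 * ?b - A$2$1 * ?a"
    using det by algebra+
  have cop: "coprime a b" using v by (simp add: reduced_rational_def)
  have "coprime ?a ?b"
  proof (rule coprimeI)
    fix x assume "x dvd ?a" "x dvd ?b"
    then have "x dvd a" "x dvd b" using inv by (metis dvd_diff dvd_mult)+
    with cop show "is_unit x" by (rule coprime_common_divisor)
  qed
  moreover have "moebius A v = (if ?b = 0 then Infty else Finite (of_int ?a / of_int ?b))"
  proof (cases "b = 0")
    case True
    with cop have "a = 1 \<or> a = -1" by auto
    with True v show ?thesis by (auto simp: reduced_rational_def)
  next
    case False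
    then have v': "v = Finite (of_int a / of_int b)" using v by (simp add: reduced_rational_def)
    have den: "of_int (A$2$1) * (of_int a / of_int b) + of_int (A$2$2)
        = (of_int ?b / of_int b :: rat)"
      and num: "of_int (A$1$1) * (of_int a / of_int b) + of_int (A$1$2)
        = (of_int ?a / of_int b :: rat)"
      using False by (simp_all add: field_simps)
    show ?thesis
      unfolding v' moebius.simps den num using False by (simp del: of_int_add of_int_mult)
  qed
  ultimately show ?thesis by (simp add: reduced_rational_def)
qed

section \<open>Normalized representatives of paths\<close>

lemma normalized_rep_exists:
  assumes "v \<in> farey_paths"
  shows "\<exists>a b. normalized_rep v a b"
proof -
  have "\<forall>i. \<exists>a b. reduced_rational a b (v i)" by (simp add: reduced_rational_exists)
  then obtain p q where pq: "\<And>i. reduced_rational (p i) (q i) (v i)"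
    by metis
  define e where "e i = p i * q (i + 1) - p (i + 1) * q i" for i
  have e: "e i * e i = 1" for i
  proof -
    have "farey_adjacent (v i) (v (i + 1))" using assms by (simp add: farey_paths_def)
    then obtain a b c d where r: "reduced_rational a b (v i)" "reduced_rational c d (v (i + 1))"
      and det: "a * d - b * c = 1 \<or> a * d - b * c = -1"
      unfolding farey_adjacent_def by blast
    \<comment> \<open>Adjacency may be witnessed by representatives other than \<open>p\<close>,
      \<open>q\<close>; passing between them changes the determinant only by the sign
      \<open>s * t\<close>.\<close>
    obtain s where s: "s = 1 \<or> s = -1" "p i = s * a" "q i = s * b"
      using reduced_rational_unique[OF r(1) pq] by blast
    obtain t where t: "t = 1 \<or> t = -1" "p (i + 1) = t * c" "q (i + 1) = t * d"
      using reduced_rational_unique[OF r(2) pq] by blast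
    have "e i = s * t * (a * d - b * c)"
      unfolding e_def s t by (simp add: algebra_simps)
    then show ?thesis using s(1) t(1) det by auto
  qed
  \<comment> \<open>The signs must satisfy \<open>s (i + 1) = s i * e i\<close>, and
    \<open>s 0 = 1\<close> is chosen. One of the two intervals is always empty, so a single formula
    serves both directions. For negative \<open>i\<close> the factors \<open>e\<close> stand for
    their inverses, as each is its own inverse.\<close>
  define s where "s i = prod e {0..<i} * prod e {i..<0}" for i
  have step: "s (i + 1) = s i * e i" for i
  proof (cases "i \<ge> 0")
    case True
    then have "{0..<i+1} = insert i {0..<i}" by auto
    with True show ?thesis by (simp add: s_def)
  next
    case False
    then have "{i..<0} = insert i {i+1..<0}" by auto
    then have "s i * e i = s (i + 1) * (e i * e i)"
      using False by (simp add: s_def mult.commute mult.left_commute)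
    then show ?thesis by (simp add: e)
  qed
  have e_cases: "e i = 1 \<or> e i = -1" for i
    using e[of i] by (metis abs_mult_self_eq abs_eq_iff abs_1 zmult_eq_1_iff)
  have prod_e: "prod e I = 1 \<or> prod e I = -1" for I
  proof (induction I rule: infinite_finite_induct)
    case (insert i I)
    then show ?case using e_cases[of i] by auto
  qed auto
  have s: "s i = 1 \<or> s i = -1" for i
    using prod_e[of "{0..<i}"] prod_e[of "{i..<0}"] by (auto simp: s_def)
  have "reduced_rational (s i * p i) (s i * q i) (v i)" for i
    using s[of i] pq[of i] reduced_rational_uminus[OF pq[of i]] by auto
  moreover have "(s i * p i) * (s (i + 1) * q (i + 1)) - (s (i + 1) * p (i + 1)) * (s i * q i) = 1" for i
  proof -
    have "(s i * p i) * (s (i + 1) * q (i + 1)) - (s (i + 1) * p (i + 1)) * (s i * q i)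
        = (s i * s i) * (e i * e i)"
      unfolding step by (simp add: e_def algebra_simps)
    also have "\<dots> = 1" using s[of i] e[of i] by auto
    finally show ?thesis .
  qed
  ultimately have "normalized_rep v (\<lambda>i. s i * p i) (\<lambda>i. s i * q i)"
    by (simp add: normalized_rep_def)
  then show ?thesis by blast
qed

text \<open>Each vertex leaves one sign open, and determinant 1 on consecutive vertices forces
  neighbouring signs to agree, so only a global sign remains.\<close>

lemma normalized_rep_unique:
  assumes ab: "normalized_rep v a b" and cd: "normalized_rep v c d"
  shows "(c = a \<and> d = b) \<or> (c = (\<lambda>i. - a i) \<and> d = (\<lambda>i. - b i))"
proof -
  have "\<forall>i. \<exists>s::int. (s = 1 \<or> s = -1) \<and> c i = s * a i \<and> d i = s * b i"
    using ab cd by (auto simp: normalized_rep_def intro: reduced_rational_unique)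
  then obtain s :: "int \<Rightarrow> int" where
    s: "\<And>i. s i = 1 \<or> s i = -1" "\<And>i. c i = s i * a i" "\<And>i. d i = s i * b i"
    by metis
  have step: "s (i + 1) = s i" for i
  proof -
    have "1 = c i * d (i + 1) - c (i + 1) * d i" using cd by (simp add: normalized_rep_def)
    also have "\<dots> = s i * s (i + 1) * (a i * b (i + 1) - a (i + 1) * b i)"
      by (simp add: s(2,3) algebra_simps)
    finally have "s i * s (i + 1) = 1" using ab by (simp add: normalized_rep_def)
    then show ?thesis using s(1)[of i] by auto
  qed
  have "s i = s 0" for i
  proof (induction i rule: int_induct[where k = 0])
    case (step2 i)
    then show ?case using step[of "i - 1"] by simp
  qed (simp_all add: step)
  then show ?thesis using s(1)[of 0] s(2,3) by (metis ext mult_1 mult_minus1)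
qed

lemma normalized_rep_uminus:
  "normalized_rep v a b \<Longrightarrow> normalized_rep v (\<lambda>i. - a i) (\<lambda>i. - b i)"
  by (simp add: normalized_rep_def reduced_rational_uminus)

lemma normalized_rep_farey_path:
  assumes "normalized_rep v a b"
  shows "v \<in> farey_paths"
  unfolding farey_paths_def farey_adjacent_def mem_Collect_eq
proof
  fix i
  have "a i * b (i + 1) - b i * a (i + 1) = 1"
    using assms by (simp add: normalized_rep_def mult.commute)
  then show "\<exists>p q r s. reduced_rational p q (v i) \<and> reduced_rational r s (v (i + 1)) \<and>
      (p * s - q * r = 1 \<or> p * s - q * r = -1)"
    using assms unfolding normalized_rep_def by blast
qed

text \<open>Serves surjectivity: determinant 1 already makes each pair coprime, so sequences read
  off a tiling define a path.\<close>

lemma normalized_rep_of_unimodular: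
  assumes "\<And>i. a i * b (i + 1) - a (i + 1) * b i = 1"
  shows "\<exists>v. normalized_rep v a b"
proof -
  have "coprime (a i) (b i)" for i
    by (rule coprime_if_det_eq_1[of _ "b (i + 1)" _ "a (i + 1)"])
      (use assms[of i] in \<open>simp add: mult.commute\<close>)
  then have "normalized_rep (\<lambda>i. if b i = 0 then Infty else Finite (of_int (a i) / of_int (b i))) a b"
    using assms by (simp add: normalized_rep_def reduced_rational_def)
  then show ?thesis by blast
qed

lemma normalized_rep_moebius:
  assumes A: "A \<in> SL2Z" and v: "normalized_rep v a b"
  shows "normalized_rep (moebius A \<circ> v)
    (\<lambda>i. A$1$1 * a i + A$1$2 * b i) (\<lambda>i. A$2$1 * a i + A$2$2 * b i)"
proof -
  have det: "A$1$1 * A$2$2 - A$1$2 * A$2$1 = 1"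
    using A by (simp add: SL2Z_def det_2)
  have uni: "a i * b (i + 1) - a (i + 1) * b i = 1" for i
    using v by (simp add: normalized_rep_def)
  have "(A$1$1 * a i + A$1$2 * b i) * (A$2$1 * a (i + 1) + A$2$2 * b (i + 1)) -
      (A$1$1 * a (i + 1) + A$1$2 * b (i + 1)) * (A$2$1 * a i + A$2$2 * b i)
    = (A$1$1 * A$2$2 - A$1$2 * A$2$1) * (a i * b (i + 1) - a (i + 1) * b i)" for i
    by (simp add: algebra_simps)
  then show ?thesis
    using v A by (simp add: normalized_rep_def reduced_rational_moebius det uni)
qed

lemma normalized_rep_path_unique:
  assumes "normalized_rep v a b" "normalized_rep w a b"
  shows "v = w"
  using assms by (auto simp: normalized_rep_def reduced_rational_def)

section \<open>Tilings of pairs of paths and their invariance\<close>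

lemma Phi_tilde_eq:
  assumes "normalized_rep \<gamma> a b" "normalized_rep \<delta> c d"
  shows "Phi_tilde (\<gamma>, \<delta>) =
    {\<lambda>i j. a i * d j - b i * c j, \<lambda>i j. - (a i * d j - b i * c j)}"
proof (intro equalityI subsetI)
  fix m assume "m \<in> Phi_tilde (\<gamma>, \<delta>)"
  then obtain a' b' c' d' where r: "normalized_rep \<gamma> a' b'" "normalized_rep \<delta> c' d'"
    and m: "m = (\<lambda>i j. a' i * d' j - b' i * c' j)"
    by (auto simp: Phi_tilde_def)
  \<comment> \<open>The signs of the two paths are independent, but only their product reaches the
    tiling: four choices yield two tilings.\<close>
  show "m \<in> {\<lambda>i j. a i * d j - b i * c j, \<lambda>i j. - (a i * d j - b i * c j)}"
    using normalized_rep_unique[OF assms(1) r(1)] normalized_rep_unique[OF assms(2) r(2)]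
    unfolding m by auto
next
  fix m assume m: "m \<in> {\<lambda>i j. a i * d j - b i * c j, \<lambda>i j. - (a i * d j - b i * c j)}"
  then show "m \<in> Phi_tilde (\<gamma>, \<delta>)"
  proof
    assume "m = (\<lambda>i j. a i * d j - b i * c j)"
    then show ?thesis using assms by (auto simp: Phi_tilde_def)
  next
    assume "m \<in> {\<lambda>i j. - (a i * d j - b i * c j)}"
    then have "m = (\<lambda>i j. (- a i) * d j - (- b i) * c j)" by auto
    then show ?thesis
      using normalized_rep_uminus[OF assms(1)] assms(2) unfolding Phi_tilde_def by blast
  qed
qed

lemma tame_iff:
  "tame m \<longleftrightarrow> (\<forall>i j.
     m i j * (m (i + 1) (j + 1) * m (i + 2) (j + 2) - m (i + 1) (j + 2) * m (i + 2) (j + 1))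
   - m i (j + 1) * (m (i + 1) j * m (i + 2) (j + 2) - m (i + 1) (j + 2) * m (i + 2) j)
   + m i (j + 2) * (m (i + 1) j * m (i + 2) (j + 1) - m (i + 1) (j + 1) * m (i + 2) j) = 0)"
  unfolding tame_def det_3 vector_3 by (simp add: algebra_simps)

text \<open>As a matrix, \<open>m\<close> factors through rank 2: its consecutive 2x2 minors are
  products of consecutive determinants of the two paths, and its 3x3 minors vanish.\<close>

lemma Phi_tilde_tame:
  assumes "m \<in> Phi_tilde (\<gamma>, \<delta>)"
  shows "m \<in> tame_SL2_tilings"
proof -
  obtain a b c d where r: "normalized_rep \<gamma> a b" "normalized_rep \<delta> c d"
    and m: "m = (\<lambda>i j. a i * d j - b i * c j)"
    using assms by (auto simp: Phi_tilde_def)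
  have ab: "a i * b (i + 1) - a (i + 1) * b i = 1" and cd: "c i * d (i + 1) - c (i + 1) * d i = 1"
    for i using r by (simp_all add: normalized_rep_def)
  have "m i j * m (i + 1) (j + 1) - m i (j + 1) * m (i + 1) j = 1" for i j
    unfolding m using ab[of i] cd[of j] by algebra
  moreover have "tame m"
    unfolding tame_iff m by (simp add: algebra_simps)
  ultimately show ?thesis by (simp add: tame_SL2_tilings_def SL2_tiling_def)
qed

text \<open>Applying \<open>A\<close> to both vectors multiplies their determinant by
  \<open>det A = 1\<close>.\<close>

lemma Phi_tilde_moebius:
  assumes A: "A \<in> SL2Z" and "\<gamma> \<in> farey_paths" "\<delta> \<in> farey_paths"
  shows "Phi_tilde (moebius A \<circ> \<gamma>, moebius A \<circ> \<delta>) = Phi_tilde (\<gamma>, \<delta>)"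
proof -
  obtain a b c d where r: "normalized_rep \<gamma> a b" "normalized_rep \<delta> c d"
    using normalized_rep_exists assms(2,3) by metis
  have "A$1$1 * A$2$2 - A$1$2 * A$2$1 = 1"
    using A by (simp add: SL2Z_def det_2)
  then have "(A$1$1 * a i + A$1$2 * b i) * (A$2$1 * c j + A$2$2 * d j) -
      (A$2$1 * a i + A$2$2 * b i) * (A$1$1 * c j + A$1$2 * d j) = a i * d j - b i * c j" for i j
    by algebra
  then show ?thesis
    by (simp add: Phi_tilde_eq[OF r]
        Phi_tilde_eq[OF normalized_rep_moebius[OF A r(1)] normalized_rep_moebius[OF A r(2)]])
qed

section \<open>Injectivity: the orbit relation as a kernel\<close>

lemma same_tiling_imp_SL2Z:
  fixes a b c d a' b' c' d' :: "int \<Rightarrow> int"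
  assumes ab: "\<And>i. a i * b (i + 1) - a (i + 1) * b i = 1"
    and ab': "\<And>i. a' i * b' (i + 1) - a' (i + 1) * b' i = 1"
    and cd': "\<And>j. c' j * d' (j + 1) - c' (j + 1) * d' j = 1"
    and eq: "\<And>i j. a' i * d' j - b' i * c' j = a i * d j - b i * c j"
  shows "\<exists>A\<in>SL2Z.
    a' = (\<lambda>i. A$1$1 * a i + A$1$2 * b i) \<and> b' = (\<lambda>i. A$2$1 * a i + A$2$2 * b i) \<and>
    c' = (\<lambda>j. A$1$1 * c j + A$1$2 * d j) \<and> d' = (\<lambda>j. A$2$1 * c j + A$2$2 * d j)"
proof -
  \<comment> \<open>Entries of the matrix with columns \<open>u' 0, u' 1\<close> times the inverse
    of the matrix with columns \<open>u 0, u 1\<close>, where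
    \<open>u' i = (a' i, b' i)\<close>.\<close>
  define p q r s where "p = a' 0 * b 1 - a' 1 * b 0" and "q = a' 1 * a 0 - a' 0 * a 1"
    and "r = b' 0 * b 1 - b' 1 * b 0" and "s = b' 1 * a 0 - b' 0 * a 1"
  note pqrs = this
  have ab0: "a 0 * b 1 - a 1 * b 0 = 1" and ab'0: "a' 0 * b' 1 - a' 1 * b' 0 = 1"
    and cd'0: "c' 0 * d' 1 - c' 1 * d' 0 = 1"
    using ab[of 0] ab'[of 0] cd'[of 0] by simp_all
  have det: "p * s - q * r = 1"
    unfolding pqrs using ab0 ab'0 by algebra
  have w: "c' j = p * c j + q * d j" "d' j = r * c j + s * d j" for j
    unfolding pqrs using ab0 ab'0 eq[of 0 j] eq[of 1 j] by algebra+
  \<comment> \<open>The roles are exchanged: \<open>u' i\<close> and the image of \<open>u i\<close>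
    have the same determinants against the basis formed by \<open>(c' 0, d' 0)\<close> and
    \<open>(c' 1, d' 1)\<close>.\<close>
  have u: "a' i = p * a i + q * b i" "b' i = r * a i + s * b i" for i
  proof -
    have eq': "a' i * d' j - b' i * c' j = (p * a i + q * b i) * d' j - (r * a i + s * b i) * c' j" for j
      unfolding eq unfolding w using det by algebra
    show "a' i = p * a i + q * b i" "b' i = r * a i + s * b i"
      using eq'[of 0] eq'[of 1] cd'0 by algebra+
  qed
  define A :: "int^2^2" where "A = vector [vector [p, q], vector [r, s]]"
  have A: "A$1$1 = p" "A$1$2 = q" "A$2$1 = r" "A$2$2 = s" by (simp_all add: A_def)
  have "A \<in> SL2Z" using det by (simp add: SL2Z_def det_2 A)
  then show ?thesis using u w by (intro bexI[of _ A]) (auto simp: A)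
qed

lemma Phi_tilde_eq_imp_moebius:
  assumes "\<gamma> \<in> farey_paths" "\<delta> \<in> farey_paths" "\<gamma>' \<in> farey_paths" "\<delta>' \<in> farey_paths"
    and eq: "Phi_tilde (\<gamma>, \<delta>) = Phi_tilde (\<gamma>', \<delta>')"
  shows "\<exists>A\<in>SL2Z. \<gamma>' = moebius A \<circ> \<gamma> \<and> \<delta>' = moebius A \<circ> \<delta>"
proof -
  obtain a b c d where r: "normalized_rep \<gamma> a b" "normalized_rep \<delta> c d"
    using normalized_rep_exists assms(1,2) by metis
  have "(\<lambda>i j. a i * d j - b i * c j) \<in> Phi_tilde (\<gamma>', \<delta>')"
    using Phi_tilde_eq[OF r] eq by auto
  \<comment> \<open>Representatives of the second pair are chosen to give the same tiling exactly,
    which absorbs the sign.\<close>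
  then obtain a' b' c' d' where r': "normalized_rep \<gamma>' a' b'" "normalized_rep \<delta>' c' d'"
    and m: "(\<lambda>i j. a i * d j - b i * c j) = (\<lambda>i j. a' i * d' j - b' i * c' j)"
    unfolding Phi_tilde_def by blast
  have eq': "a' i * d' j - b' i * c' j = a i * d j - b i * c j" for i j
    using fun_cong[OF fun_cong[OF m, of i], of j] by simp
  have "a i * b (i + 1) - a (i + 1) * b i = 1" "a' i * b' (i + 1) - a' (i + 1) * b' i = 1"
    "c' i * d' (i + 1) - c' (i + 1) * d' i = 1" for i
    using r r' by (simp_all add: normalized_rep_def)
  from same_tiling_imp_SL2Z[where a = a and b = b and c = c and d = d
      and a' = a' and b' = b' and c' = c' and d' = d', OF this eq'] obtain A where A: "A \<in> SL2Z"
    and A': "a' = (\<lambda>i. A$1$1 * a i + A$1$2 * b i)" "b' = (\<lambda>i. A$2$1 * a i + A$2$2 * b i)"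
      "c' = (\<lambda>j. A$1$1 * c j + A$1$2 * d j)" "d' = (\<lambda>j. A$2$1 * c j + A$2$2 * d j)"
    by blast
  have "normalized_rep (moebius A \<circ> \<gamma>) a' b'" "normalized_rep (moebius A \<circ> \<delta>) c' d'"
    unfolding A' using A r by (simp_all only: normalized_rep_moebius)
  then have "\<gamma>' = moebius A \<circ> \<gamma>" "\<delta>' = moebius A \<circ> \<delta>"
    using r' by (simp_all only: normalized_rep_path_unique)
  with A show ?thesis by blast
qed

text \<open>Invariance gives one direction and matching of bases the other. With a kernel in place
  of orbits, well-definedness and injectivity of \<open>Phi\<close> become formal.\<close>

lemma orbit_rel_eq:
  "orbit_rel = {(x, y). x \<in> farey_paths \<times> farey_paths \<and> y \<in> farey_paths \<times> farey_paths \<and>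
     Phi_tilde x = Phi_tilde y}"
proof -
  have "Phi_tilde (\<gamma>, \<delta>) = Phi_tilde (\<gamma>', \<delta>')
      \<longleftrightarrow> (\<exists>A\<in>SL2Z. \<gamma>' = moebius A \<circ> \<gamma> \<and> \<delta>' = moebius A \<circ> \<delta>)"
    if "\<gamma> \<in> farey_paths" "\<delta> \<in> farey_paths" "\<gamma>' \<in> farey_paths" "\<delta>' \<in> farey_paths"
    for \<gamma> \<delta> \<gamma>' \<delta>'
    using that Phi_tilde_moebius Phi_tilde_eq_imp_moebius by blast
  then have "(x, y) \<in> orbit_rel \<longleftrightarrow> x \<in> farey_paths \<times> farey_paths \<and>
      y \<in> farey_paths \<times> farey_paths \<and> Phi_tilde x = Phi_tilde y" for x y
    by (cases x; cases y) (simp add: orbit_rel_def cong: conj_cong)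
  then show ?thesis by auto
qed

lemma Phi_orbit:
  assumes "x \<in> farey_paths \<times> farey_paths"
  shows "Phi (orbit_rel `` {x}) = Phi_tilde x"
proof -
  have "Phi_tilde ` (orbit_rel `` {x}) = {Phi_tilde x}"
    using assms by (auto simp: orbit_rel_eq)
  then show ?thesis by (simp add: Phi_def)
qed

section \<open>Surjectivity: recovering paths from a tame tiling\<close>

lemma tame_column_recurrence:
  assumes "SL2_tiling m" "tame m"
  shows "\<exists>k. \<forall>i j. m i (j + 2) = k j * m i (j + 1) - m i j"
proof -
  define K where "K i j = m i j * m (i + 1) (j + 2) - m i (j + 2) * m (i + 1) j" for i j
  have S: "m i j * m (i + 1) (j + 1) - m i (j + 1) * m (i + 1) j = 1" for i j
    using assms(1) by (simp add: SL2_tiling_def)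
  have S2: "m i (j + 1) * m (i + 1) (j + 2) - m i (j + 2) * m (i + 1) (j + 1) = 1" for i j
    using S[of i "j + 1"] by (simp add: add.assoc)
  \<comment> \<open>The cross product of rows \<open>i\<close> and \<open>i + 1\<close> is \<open>(1, - K i j, 1)\<close>; tameness makes it orthogonal
    to row \<open>i + 2\<close> as well.\<close>
  have r0: "m i (j + 2) = K i j * m i (j + 1) - m i j" for i j
    unfolding K_def using S[of i j] S2[of i j] by algebra
  have r1: "m (i + 1) (j + 2) = K i j * m (i + 1) (j + 1) - m (i + 1) j" for i j
    unfolding K_def using S[of i j] S2[of i j] by algebra
  have r2: "m (i + 2) (j + 2) = K i j * m (i + 2) (j + 1) - m (i + 2) j" for i j
  proof -
    have "m i j * (m (i + 1) (j + 1) * m (i + 2) (j + 2) - m (i + 1) (j + 2) * m (i + 2) (j + 1))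
      - m i (j + 1) * (m (i + 1) j * m (i + 2) (j + 2) - m (i + 1) (j + 2) * m (i + 2) j)
      + m i (j + 2) * (m (i + 1) j * m (i + 2) (j + 1) - m (i + 1) (j + 1) * m (i + 2) j) = 0"
      using assms(2) by (simp add: tame_iff)
    then show ?thesis unfolding K_def using S[of i j] S2[of i j] by algebra
  qed
  \<comment> \<open>Rows \<open>i + 1\<close> and \<open>i + 2\<close> obey the recurrence with both
    coefficients, so the difference of the coefficients annihilates their entries in column
    \<open>j + 1\<close>. By \<open>S2\<close> an integer combination of these entries is 1.\<close>
  have step: "K (i + 1) j = K i j" for i j
    using r1[of i j] r0[of "i + 1" j] r2[of i j] r1[of "i + 1" j] S2[of "i + 1" j]
    by (simp add: add.assoc) algebra
  have "K i j = K 0 j" for i j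
  proof (induction i rule: int_induct[where k = 0])
    case (step2 i)
    then show ?case using step[of "i - 1"] by simp
  qed (simp_all add: step)
  with r0 have "m i (j + 2) = K 0 j * m i (j + 1) - m i j" for i j by metis
  then show ?thesis by blast
qed

text \<open>The coefficient of \<open>x j\<close> is the unit -1, so the recurrence also runs
  backwards; the induction carries two consecutive values.\<close>

lemma linear_recurrence_unique:
  fixes x y k :: "int \<Rightarrow> int"
  assumes x: "\<And>j. x (j + 2) = k j * x (j + 1) - x j"
    and y: "\<And>j. y (j + 2) = k j * y (j + 1) - y j"
    and "x 0 = y 0" "x 1 = y 1"
  shows "x j = y j"
proof -
  have "x j = y j \<and> x (j + 1) = y (j + 1)"
  proof (induction j rule: int_induct[where k = 0])
    case base
    then show ?case using assms by simp
  next
    case (step1 i)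
    then show ?case using x[of i] y[of i] by (simp add: add.assoc)
  next
    case (step2 i)
    then have "x (i - 1 + 2) = y (i - 1 + 2)" "x (i - 1 + 1) = y (i - 1 + 1)"
      by (simp_all add: add.commute)
    then show ?case using x[of "i - 1"] y[of "i - 1"] by simp
  qed
  then show ?thesis ..
qed

lemma tame_SL2_tiling_in_Phi_tilde:
  assumes "m \<in> tame_SL2_tilings"
  shows "\<exists>\<gamma>\<in>farey_paths. \<exists>\<delta>\<in>farey_paths. m \<in> Phi_tilde (\<gamma>, \<delta>)"
proof -
  have m: "SL2_tiling m" "tame m" using assms by (simp_all add: tame_SL2_tilings_def)
  then have S: "m i j * m (i + 1) (j + 1) - m i (j + 1) * m (i + 1) j = 1" for i j
    by (simp add: SL2_tiling_def)
  obtain k where k: "\<And>i j. m i (j + 2) = k j * m i (j + 1) - m i j"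
    using tame_column_recurrence[OF m] by blast
  \<comment> \<open>Normalise \<open>u 0 = (1, 0)\<close> and \<open>u 1 = (0, 1)\<close>. Then \<open>c, d\<close> are read off rows 0 and 1, and
    \<open>a, b\<close> solve \<open>a i * d j - b i * c j = m i j\<close> for \<open>j = 0, 1\<close>.\<close>
  define c d where "c j = - m 1 j" and "d j = m 0 j" for j
  define a b where "a i = m i 1 * c 0 - m i 0 * c 1" and "b i = m i 1 * d 0 - m i 0 * d 1" for i
  have cd: "c j * d (j + 1) - c (j + 1) * d j = 1" for j
    using S[of 0 j] by (simp add: c_def d_def algebra_simps)
  have cd0: "c 0 * d 1 - c 1 * d 0 = 1" using cd[of 0] by simp
  \<comment> \<open>Up to two cancelling signs, this determinant is the minor of \<open>m\<close> in
    rows \<open>i, i + 1\<close> and columns 0, 1 times the determinant in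
    \<open>cd0\<close>.\<close>
  have ab: "a i * b (i + 1) - a (i + 1) * b i = 1" for i
    unfolding a_def b_def using cd0 S[of i 0] by simp algebra
  \<comment> \<open>Since \<open>c\<close> and \<open>d\<close> are rows of \<open>m\<close> up to
    sign, both sides obey the same recurrence in \<open>j\<close>.\<close>
  have "m i j = a i * d j - b i * c j" for i j
  proof (rule linear_recurrence_unique[where k = k and x = "\<lambda>j. m i j"
        and y = "\<lambda>j. a i * d j - b i * c j"])
    show "m i (j + 2) = k j * m i (j + 1) - m i j" for j by (rule k)
    show "a i * d (j + 2) - b i * c (j + 2) =
        k j * (a i * d (j + 1) - b i * c (j + 1)) - (a i * d j - b i * c j)" for j
      unfolding c_def d_def k by (simp add: algebra_simps)
    show "m i 0 = a i * d 0 - b i * c 0" "m i 1 = a i * d 1 - b i * c 1"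
      unfolding a_def b_def using cd0 by algebra+
  qed
  then have "m = (\<lambda>i j. a i * d j - b i * c j)" by blast
  moreover obtain \<gamma> \<delta> where "normalized_rep \<gamma> a b" "normalized_rep \<delta> c d"
    using normalized_rep_of_unimodular ab cd by metis
  ultimately show ?thesis
    using normalized_rep_farey_path unfolding Phi_tilde_def by blast
qed

section \<open>Sign classes and the bijection\<close>

lemma sign_class_eq_Phi_tilde:
  assumes "m \<in> Phi_tilde (\<gamma>, \<delta>)"
  shows "sign_rel `` {m} = Phi_tilde (\<gamma>, \<delta>)"
proof -
  obtain a b c d where r: "normalized_rep \<gamma> a b" "normalized_rep \<delta> c d"
    and m: "m = (\<lambda>i j. a i * d j - b i * c j)"
    using assms by (auto simp: Phi_tilde_def)
  have eq: "Phi_tilde (\<gamma>, \<delta>) = {m, \<lambda>i j. - m i j}"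
    using Phi_tilde_eq[OF r] by (simp add: m)
  then have "m \<in> tame_SL2_tilings" "(\<lambda>i j. - m i j) \<in> tame_SL2_tilings"
    using Phi_tilde_tame by auto
  then show ?thesis unfolding eq by (auto simp: sign_rel_def)
qed

text \<open>A value of \<open>Phi_tilde\<close> is the full sign class of any of its members, and
  every tame tiling is a member of some value.\<close>

lemma image_Phi_tilde:
  "Phi_tilde ` (farey_paths \<times> farey_paths) = tame_SL2_tilings_mod_sign"
proof (intro equalityI subsetI)
  fix X assume "X \<in> Phi_tilde ` (farey_paths \<times> farey_paths)"
  then obtain \<gamma> \<delta> where \<gamma>\<delta>: "\<gamma> \<in> farey_paths" "\<delta> \<in> farey_paths" and X: "X = Phi_tilde (\<gamma>, \<delta>)"
    by auto
  obtain a b c d where "normalized_rep \<gamma> a b" "normalized_rep \<delta> c d"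
    using normalized_rep_exists \<gamma>\<delta> by metis
  then obtain m where "m \<in> Phi_tilde (\<gamma>, \<delta>)" by (auto simp: Phi_tilde_eq)
  then show "X \<in> tame_SL2_tilings_mod_sign"
    unfolding X tame_SL2_tilings_mod_sign_def
    using sign_class_eq_Phi_tilde Phi_tilde_tame by (metis quotientI)
next
  fix X assume "X \<in> tame_SL2_tilings_mod_sign"
  then obtain m where m: "m \<in> tame_SL2_tilings" "X = sign_rel `` {m}"
    by (auto simp: tame_SL2_tilings_mod_sign_def elim: quotientE)
  then obtain \<gamma> \<delta> where "\<gamma> \<in> farey_paths" "\<delta> \<in> farey_paths" "m \<in> Phi_tilde (\<gamma>, \<delta>)"
    using tame_SL2_tiling_in_Phi_tilde by blast
  then show "X \<in> Phi_tilde ` (farey_paths \<times> farey_paths)"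
    using sign_class_eq_Phi_tilde m(2) by force
qed

theorem theorem1p1:
  shows "(\<forall>\<gamma>\<in>farey_paths. \<forall>\<delta>\<in>farey_paths.
            Phi (orbit_rel `` {(\<gamma>, \<delta>)}) = Phi_tilde (\<gamma>, \<delta>)) \<and>
         bij_betw Phi path_pair_orbits tame_SL2_tilings_mod_sign"
proof
  show "\<forall>\<gamma>\<in>farey_paths. \<forall>\<delta>\<in>farey_paths.
      Phi (orbit_rel `` {(\<gamma>, \<delta>)}) = Phi_tilde (\<gamma>, \<delta>)"
    by (simp add: Phi_orbit)
  have orbits: "path_pair_orbits = (\<lambda>x. orbit_rel `` {x}) ` (farey_paths \<times> farey_paths)"
    by (auto simp: path_pair_orbits_def quotient_def)
  have "inj_on Phi path_pair_orbits"
  proof (rule inj_onI)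
    fix X Y assume "X \<in> path_pair_orbits" "Y \<in> path_pair_orbits" and eq: "Phi X = Phi Y"
    then obtain x y where x: "x \<in> farey_paths \<times> farey_paths" "X = orbit_rel `` {x}"
      and y: "y \<in> farey_paths \<times> farey_paths" "Y = orbit_rel `` {y}"
      unfolding orbits by blast
    then have "Phi_tilde x = Phi_tilde y" using eq Phi_orbit by metis
    then show "X = Y" using x y by (auto simp: orbit_rel_eq)
  qed
  moreover have "Phi ` path_pair_orbits = tame_SL2_tilings_mod_sign"
    unfolding orbits image_image image_Phi_tilde[symmetric] by (simp add: Phi_orbit cong: image_cong)
  ultimately show "bij_betw Phi path_pair_orbits tame_SL2_tilings_mod_sign"
    by (simp add: bij_betw_def)
qed

end
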